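(* Let $Q$ be a poset with least element $0$. Then the zero-divisor graph $\Gamma(Q)$ is complemented if and only if $\Gamma(Q)$ is uniquely complemented.
   Context: For $A\subseteq Q$, $A^\ell$ denotes the set of lower bounds of $A$. $\Gamma(Q)$ is the simple graph whose vertices are the non-zero $x\in Q$ for which there is $y\in Q\setminus\{0\}$ with $\{x,y\}^\ell=\{0\}$, distinct vertices $x,y$ being adjacent iff $\{x,y\}^\ell=\{0\}$. In a graph $G$, for distinct vertices $a,b$ write $a\bot b$ if $a$ and $b$ are adjacent and no vertex of $G$ is adjacent to both $a$ and $b$. $G$ is complemented if for each vertex $a$ there is a vertex $b$ with $a\bot b$. $G$ is uniquely complemented if it is complemented and whenever $a\bot b$ and $a\bot c$, then $b$ and $c$ are adjacent to exactly the same vertices. *)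

theory Defs
  imports Main
begin

definition lower_bounds :: "'a::order set \<Rightarrow> 'a set" where
  "lower_bounds A = {l. \<forall>a\<in>A. l \<le> a}"

text \<open>A simple graph is a vertex set together with a set of two-element subsets of it.\<close>

record 'v graph =
  verts :: "'v set"
  edges :: "'v set set"

definition simple_graph :: "'v graph \<Rightarrow> bool" where
  "simple_graph G \<longleftrightarrow> (\<forall>e\<in>edges G. e \<subseteq> verts G \<and> card e = 2)"

definition adjacent :: "'v graph \<Rightarrow> 'v \<Rightarrow> 'v \<Rightarrow> bool" where
  "adjacent G a b \<longleftrightarrow> {a, b} \<in> edges G"

definition perp :: "'v graph \<Rightarrow> 'v \<Rightarrow> 'v \<Rightarrow> bool" where
  "perp G a b \<longleftrightarrow> a \<in> verts G \<and> b \<in> verts G \<and> a \<noteq> b \<and> adjacent G a b \<and>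
     \<not> (\<exists>c\<in>verts G. adjacent G c a \<and> adjacent G c b)"

definition complemented :: "'v graph \<Rightarrow> bool" where
  "complemented G \<longleftrightarrow> (\<forall>a\<in>verts G. \<exists>b\<in>verts G. perp G a b)"

definition uniquely_complemented :: "'v graph \<Rightarrow> bool" where
  "uniquely_complemented G \<longleftrightarrow> complemented G \<and>
     (\<forall>a\<in>verts G. \<forall>b\<in>verts G. \<forall>c\<in>verts G. perp G a b \<longrightarrow> perp G a c \<longrightarrow>
        (\<forall>x\<in>verts G. adjacent G b x \<longleftrightarrow> adjacent G c x))"

text \<open>The poset \<open>Q\<close> is the whole type \<^typ>\<open>'a\<close>, and its least element \<open>0\<close> is \<^const>\<open>bot\<close>.\<close>

definition zero_divisors :: "'a::order_bot set" where
  "zero_divisors = {x. x \<noteq> bot \<and> (\<exists>y. y \<noteq> bot \<and> lower_bounds {x, y} = {bot})}"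

definition zero_divisor_graph :: "'a::order_bot graph" where
  "zero_divisor_graph = \<lparr>verts = zero_divisors,
     edges = {{x, y} |x y. x \<in> zero_divisors \<and> y \<in> zero_divisors \<and> x \<noteq> y \<and>
       lower_bounds {x, y} = {bot}}\<rparr>"

lemma simple_graph_zero_divisor_graph: "simple_graph zero_divisor_graph"
  by (auto simp: simple_graph_def zero_divisor_graph_def)

lemma adjacent_zero_divisor_graph_iff:
  "adjacent zero_divisor_graph x y \<longleftrightarrow>
     x \<in> zero_divisors \<and> y \<in> zero_divisors \<and> x \<noteq> y \<and> lower_bounds {x, y} = {bot}"
proof -
  have "lower_bounds {y, x} = lower_bounds {x, y}"
    by (simp add: insert_commute)
  then show ?thesis
    unfolding adjacent_def zero_divisor_graph_def by (simp add: doubleton_eq_iff) blast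
qed

end

theory Submission
  imports Defs
begin

text \<open>Adjacency is disjointness of non-zero elements, and it passes to smaller non-zero
  elements. Hence if \<open>perp\<close> holds of \<open>a\<close> and \<open>b\<close>, every
  neighbour of \<open>a\<close> is adjacent to every neighbour of \<open>b\<close>. A second
  complement \<open>c\<close> of \<open>a\<close> is a neighbour of \<open>a\<close>, so it is
  adjacent to all neighbours of \<open>b\<close>.\<close>

lemma lower_bounds_pair_eq_bot_iff:
  fixes x y :: "'a::order_bot"
  shows "lower_bounds {x, y} = {bot} \<longleftrightarrow> (\<forall>l. l \<le> x \<longrightarrow> l \<le> y \<longrightarrow> l = bot)"
  by (auto simp: lower_bounds_def)

text \<open>Disjoint non-zero elements witness each other's membership in
  \<open>zero_divisors\<close>, and they are distinct since a non-zero element is a lower bound of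
  itself.\<close>

lemma adjacent_zero_divisor_graph_iff_disjoint:
  fixes x y :: "'a::order_bot"
  shows "adjacent zero_divisor_graph x y \<longleftrightarrow>
    x \<noteq> bot \<and> y \<noteq> bot \<and> (\<forall>l. l \<le> x \<longrightarrow> l \<le> y \<longrightarrow> l = bot)"
  unfolding adjacent_zero_divisor_graph_iff zero_divisors_def lower_bounds_pair_eq_bot_iff
  by blast

lemma adjacent_zero_divisor_graph_imp_verts:
  "adjacent zero_divisor_graph x y \<Longrightarrow> x \<in> verts zero_divisor_graph"
  unfolding adjacent_zero_divisor_graph_iff by (simp add: zero_divisor_graph_def)

text \<open>A non-zero common lower bound of \<open>c\<close> and \<open>x\<close> would be adjacent to both \<open>a\<close> and \<open>b\<close>.\<close>

lemma perp_zero_divisor_graph_adjacent: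
  fixes a b c x :: "'a::order_bot"
  assumes ab: "perp zero_divisor_graph a b" and ac: "adjacent zero_divisor_graph a c"
    and bx: "adjacent zero_divisor_graph b x"
  shows "adjacent zero_divisor_graph c x"
proof (rule ccontr)
  assume "\<not> adjacent zero_divisor_graph c x"
  then obtain d where d: "d \<le> c" "d \<le> x" "d \<noteq> bot"
    using ac bx by (auto simp: adjacent_zero_divisor_graph_iff_disjoint)
  have "adjacent zero_divisor_graph d a" "adjacent zero_divisor_graph d b"
    using ac bx d unfolding adjacent_zero_divisor_graph_iff_disjoint by (meson order_trans)+
  then show False
    using ab adjacent_zero_divisor_graph_imp_verts unfolding perp_def by blast
qed

theorem theorem2p10:
  "complemented (zero_divisor_graph :: 'a::order_bot graph) \<longleftrightarrow>
   uniquely_complemented (zero_divisor_graph :: 'a graph)"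
  unfolding uniquely_complemented_def
  \<comment> \<open>The lemma serves twice, the second time with \<open>b\<close> and
    \<open>c\<close> exchanged.\<close>
  using perp_zero_divisor_graph_adjacent perp_def by metis

end
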